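(* For every $w\in\beta\mathbb Z\setminus\{0\}$, the relation $\equiv_w$ on $\beta\mathbb Z$ is an equivalence relation if and only if it is transitive.
   Context: $\beta\mathbb Z$ is the space of ultrafilters on $\mathbb Z$; integers are identified with principal ultrafilters. For $u,v\in\beta\mathbb Z$: $A\in u\otimes v$ iff $\{x:\{y:(x,y)\in A\}\in v\}\in u$ (for $A\subseteq\mathbb Z^2$); $A\in u\oplus v$ iff $\{x:\{y:x+y\in A\}\in v\}\in u$; $-u=\{-A:A\in u\}$; $u\ominus v=u\oplus(-v)$. Fix an elementary extension ${}^{*}\mathbb Z$ of $\mathbb Z$, in the language with a symbol for every subset of every $\mathbb Z^k$, that is $(2^{\aleph_0})^+$-saturated. For a tuple $a$ in ${}^{*}\mathbb Z$ and an ultrafilter $u$ on $\mathbb Z^k$, $a\models u$ means $u=\{A\subseteq\mathbb Z^k:a\in{}^{*}A\}$. For $w\in\beta\mathbb Z\setminus\{0\}$: $u\equiv_w v$ iff there are $d\models w$ and $(a,b)\models u\otimes v$ with $d\mid a-b$; equivalently, every set in $w$ that is upward closed under divisibility belongs to $u\ominus v$. *)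

theory Defs
  imports Main
begin

unbundle cardinal_syntax

section \<open>Ultrafilters on the integers\<close>

text \<open>A set \<open>A\<close> belongs to the filter \<open>u\<close> iff \<open>\<forall>\<^sub>F x in u. x \<in> A\<close>.\<close>

definition ultrafilter :: "'b filter \<Rightarrow> bool" where
  "ultrafilter u \<longleftrightarrow> u \<noteq> bot \<and> (\<forall>P. (\<forall>\<^sub>F x in u. P x) \<or> (\<forall>\<^sub>F x in u. \<not> P x))"

definition betaZ :: "int filter set" where
  "betaZ = {u. ultrafilter u}"

definition tensor :: "'b filter \<Rightarrow> 'c filter \<Rightarrow> ('b \<times> 'c) filter" (infixr \<open>\<otimes>\<close> 70) where
  "u \<otimes> v = Abs_filter (\<lambda>P. \<forall>\<^sub>F x in u. \<forall>\<^sub>F y in v. P (x, y))"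

lemma eventually_tensor:
  "eventually P (u \<otimes> v) \<longleftrightarrow> (\<forall>\<^sub>F x in u. \<forall>\<^sub>F y in v. P (x, y))"
  unfolding tensor_def
proof (rule eventually_Abs_filter, rule is_filter.intro)
  show "\<forall>\<^sub>F x in u. \<forall>\<^sub>F y in v. True" by simp
next
  fix P Q :: "'a \<times> 'b \<Rightarrow> bool"
  assume "\<forall>\<^sub>F x in u. \<forall>\<^sub>F y in v. P (x, y)" and "\<forall>\<^sub>F x in u. \<forall>\<^sub>F y in v. Q (x, y)"
  then show "\<forall>\<^sub>F x in u. \<forall>\<^sub>F y in v. P (x, y) \<and> Q (x, y)"
    by eventually_elim (rule eventually_conj)
next
  fix P Q :: "'a \<times> 'b \<Rightarrow> bool"
  assume PQ: "\<forall>z. P z \<longrightarrow> Q z" and P: "\<forall>\<^sub>F x in u. \<forall>\<^sub>F y in v. P (x, y)"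
  show "\<forall>\<^sub>F x in u. \<forall>\<^sub>F y in v. Q (x, y)"
    using P by eventually_elim (use PQ in \<open>auto elim: eventually_mono\<close>)
qed

section \<open>The full language of the integers and its structures\<close>

text \<open>
  A \<open>k\<close>-tuple is a list of length \<open>k\<close>. The relation symbols of arity \<open>k\<close> are the sets
  \<open>A \<subseteq> \<int>\<^sup>k\<close> themselves; function symbols are not needed, since functions have graphs.
  Variables are natural numbers.
\<close>

definition tuples :: "nat \<Rightarrow> 'b list set" where
  "tuples k = {xs. length xs = k}"

datatype fm =
    Equal nat nat
  | Rel "int list set" "nat list"
  | Neg fm
  | Conj fm fm
  | Exists nat fm

primrec well_formed :: "fm \<Rightarrow> bool" where
  "well_formed (Equal i j) \<longleftrightarrow> True"
| "well_formed (Rel A is) \<longleftrightarrow> A \<subseteq> tuples (length is)"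
| "well_formed (Neg p) \<longleftrightarrow> well_formed p"
| "well_formed (Conj p q) \<longleftrightarrow> well_formed p \<and> well_formed q"
| "well_formed (Exists i p) \<longleftrightarrow> well_formed p"

primrec free_vars :: "fm \<Rightarrow> nat set" where
  "free_vars (Equal i j) = {i, j}"
| "free_vars (Rel A is) = set is"
| "free_vars (Neg p) = free_vars p"
| "free_vars (Conj p q) = free_vars p \<union> free_vars q"
| "free_vars (Exists i p) = free_vars p - {i}"

text \<open>
  A structure for this language, with universe the type \<open>'a\<close>, is given by its
  interpretation \<open>S\<close> of the relation symbols: \<open>S A\<close> is \<open>\<^sup>*A\<close>. The standard structure on
  \<open>\<int>\<close> interprets every symbol by itself, so its interpretation is \<open>\<lambda>A. A\<close>.
\<close>

primrec sat :: "(int list set \<Rightarrow> 'a list set) \<Rightarrow> (nat \<Rightarrow> 'a) \<Rightarrow> fm \<Rightarrow> bool" where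
  "sat S e (Equal i j) \<longleftrightarrow> e i = e j"
| "sat S e (Rel A is) \<longleftrightarrow> map e is \<in> S A"
| "sat S e (Neg p) \<longleftrightarrow> \<not> sat S e p"
| "sat S e (Conj p q) \<longleftrightarrow> sat S e p \<and> sat S e q"
| "sat S e (Exists i p) \<longleftrightarrow> (\<exists>x. sat S (e(i := x)) p)"

text \<open>The map \<open>\<iota>\<close> is the inclusion of \<open>\<int>\<close> into the extension.\<close>

definition elementary_extension ::
    "(int list set \<Rightarrow> 'a list set) \<Rightarrow> (int \<Rightarrow> 'a) \<Rightarrow> bool" where
  "elementary_extension S \<iota> \<longleftrightarrow>
     (\<forall>p e. well_formed p \<longrightarrow> (sat S (\<iota> \<circ> e) p \<longleftrightarrow> sat (\<lambda>A. A) e p))"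

text \<open>
  A set of formulas in the free variable \<open>0\<close> with parameters from \<open>P\<close> is a set \<open>\<Gamma>\<close> of
  pairs \<open>(p, e)\<close>, where \<open>e\<close> assigns parameters to the free variables of \<open>p\<close> other than \<open>0\<close>.
\<close>

definition saturated :: "'k rel \<Rightarrow> (int list set \<Rightarrow> 'a list set) \<Rightarrow> bool" where
  "saturated \<kappa> S \<longleftrightarrow>
     (\<forall>(P :: 'a set) (\<Gamma> :: (fm \<times> (nat \<Rightarrow> 'a)) set).
        |P| <o \<kappa> \<longrightarrow>
        (\<forall>(p, e) \<in> \<Gamma>. well_formed p \<and> e ` (free_vars p - {0}) \<subseteq> P) \<longrightarrow>
        (\<forall>\<Delta> \<subseteq> \<Gamma>. finite \<Delta> \<longrightarrow> (\<exists>x. \<forall>(p, e) \<in> \<Delta>. sat S (e(0 := x)) p)) \<longrightarrow>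
        (\<exists>x. \<forall>(p, e) \<in> \<Gamma>. sat S (e(0 := x)) p))"

section \<open>Realizations and congruence modulo an ultrafilter\<close>

text \<open>
  \<open>realizes S as u\<close> is \<open>as \<Turnstile> u\<close>, for a tuple \<open>as\<close> of length \<open>k\<close> and an ultrafilter \<open>u\<close> on \<open>\<int>\<^sup>k\<close>,
  given as a filter on lists.
\<close>

definition realizes ::
    "(int list set \<Rightarrow> 'a list set) \<Rightarrow> 'a list \<Rightarrow> int list filter \<Rightarrow> bool" where
  "realizes S as u \<longleftrightarrow>
     (\<forall>A \<subseteq> tuples (length as). (\<forall>\<^sub>F xs in u. xs \<in> A) \<longleftrightarrow> as \<in> S A)"

text \<open>The nonstandard reading of \<open>d \<bar> a - b\<close>, via the symbol for this ternary relation.\<close>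

definition star_dvd_diff ::
    "(int list set \<Rightarrow> 'a list set) \<Rightarrow> 'a \<Rightarrow> 'a \<Rightarrow> 'a \<Rightarrow> bool" where
  "star_dvd_diff S d a b \<longleftrightarrow> [d, a, b] \<in> S {[x, y, z] | x y z. x dvd y - z}"

definition ultra_cong ::
    "(int list set \<Rightarrow> 'a list set) \<Rightarrow> int filter \<Rightarrow> (int filter \<times> int filter) set" where
  "ultra_cong S w = {(u, v). u \<in> betaZ \<and> v \<in> betaZ \<and>
     (\<exists>d a b. realizes S [d] (filtermap (\<lambda>x. [x]) w) \<and>
              realizes S [a, b] (filtermap (\<lambda>(x, y). [x, y]) (u \<otimes> v)) \<and>
              star_dvd_diff S d a b)}"

end

theory Submission
  imports Defs
begin

text \<open>
  Write \<open>W\<close> for the set of ultrafilters containing every set in \<open>w\<close> that is upward closed under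
  divisibility, and \<open>N\<close> for the set of integers \<open>n\<close> such that \<open>n\<int> \<in> w\<close>. If \<open>N \<in> w\<close>, then
  \<open>\<equiv>\<^sub>w\<close> is congruence modulo all \<open>n \<in> N\<close>, hence an equivalence relation. Otherwise the complement
  of \<open>N\<close> is an upward closed set in \<open>w\<close>. Choose an ultrafilter \<open>u\<close> containing \<open>N\<close> and \<open>n\<int>\<close>
  for all \<open>n \<in> N\<close>; then \<open>u \<notin> W\<close>, that is, \<open>u \<equiv>\<^sub>w 0\<close> fails. For fixed \<open>n \<noteq> 0\<close>, the value of
  \<open>gcd d n\<close> is constant for \<open>w\<close>-almost all \<open>d\<close> and belongs to \<open>N\<close>, so it divides the residue of \<open>u\<close>
  modulo \<open>n\<close>. By Bezout some multiple of \<open>d\<close> has that residue, and so there is \<open>v \<in> W\<close> with the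
  same residue as \<open>u\<close> modulo every \<open>n \<noteq> 0\<close>. Now \<open>u \<equiv>\<^sub>w v \<equiv>\<^sub>w 0\<close>, and transitivity fails.
\<close>

section \<open>Ultrafilters\<close>

lemma ultrafilter_eventually_not:
  assumes "ultrafilter u"
  shows "(\<forall>\<^sub>F x in u. \<not> P x) \<longleftrightarrow> \<not> (\<forall>\<^sub>F x in u. P x)"
proof -
  have "\<not> ((\<forall>\<^sub>F x in u. P x) \<and> (\<forall>\<^sub>F x in u. \<not> P x))"
    using assms eventually_conj[of P u "\<lambda>x. \<not> P x"]
    by (auto simp: ultrafilter_def trivial_limit_def)
  then show ?thesis using assms by (auto simp: ultrafilter_def)
qed

lemma ultrafilter_tensor:
  assumes "ultrafilter u" and "ultrafilter v"
  shows "ultrafilter (u \<otimes> v)"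
  using assms ultrafilter_eventually_not[OF assms(1)] ultrafilter_eventually_not[OF assms(2)]
  by (simp add: ultrafilter_def trivial_limit_def eventually_tensor)

lemma ultrafilter_principal_singleton: "ultrafilter (principal {x})"
  by (auto simp: ultrafilter_def eventually_principal principal_eq_bot_iff)

lemma ultrafilter_eventually_bex:
  assumes "ultrafilter u" and "finite A" and "\<forall>\<^sub>F x in u. \<exists>a\<in>A. P a x"
  shows "\<exists>a\<in>A. \<forall>\<^sub>F x in u. P a x"
proof (rule ccontr)
  assume "\<not> ?thesis"
  then have "\<forall>a\<in>A. \<forall>\<^sub>F x in u. \<not> P a x"
    by (simp add: ultrafilter_eventually_not[OF assms(1)])
  then have "\<forall>\<^sub>F x in u. \<forall>a\<in>A. \<not> P a x"
    using assms(2) by (simp add: eventually_ball_finite)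
  then have "\<forall>\<^sub>F x in u. \<not> (\<exists>a\<in>A. P a x)" by simp
  then show False using assms(3) ultrafilter_eventually_not[OF assms(1)] by blast
qed

text \<open>Smaller filters are finer, so Zorn's lemma is applied downwards; a minimal proper filter
  is an ultrafilter.\<close>

lemma ex_ultrafilter_le:
  assumes "F \<noteq> bot"
  shows "\<exists>u \<le> F. ultrafilter u"
proof -
  define A where "A = {G. G \<le> F \<and> G \<noteq> bot}"
  have "\<exists>m\<in>A. \<forall>G\<in>A. m \<ge> G \<longrightarrow> G = m"
  proof (rule predicate_Zorn)
    show "partial_order_on A (relation_of (\<ge>) A)"
      by (rule partial_order_on_relation_ofI) auto
  next
    fix C assume C: "C \<in> Chains (relation_of (\<ge>) A)"
    show "\<exists>u\<in>A. \<forall>G\<in>C. G \<ge> u"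
    proof (cases "C = {}")
      case True
      then show ?thesis using assms by (auto simp: A_def)
    next
      case False
      have sub: "C \<subseteq> A" and tot: "\<And>G H. G \<in> C \<Longrightarrow> H \<in> C \<Longrightarrow> G \<le> H \<or> H \<le> G"
        using C by (auto simp: Chains_def relation_of_def)
      \<comment> \<open>A chain is directed, so what holds eventually in its infimum already does so
        in one member; hence the infimum is proper.\<close>
      have "eventually P (Inf C) \<longleftrightarrow> (\<exists>G\<in>C. eventually P G)" for P
        by (rule eventually_Inf_base[OF False])
          (use tot in \<open>metis inf.idem inf.orderE inf_commute order_refl\<close>)
      then have "Inf C \<noteq> bot"
        using sub by (auto simp: trivial_limit_def A_def)
      moreover have "Inf C \<le> F"
        using False sub by (auto simp: A_def intro: Inf_lower2)
      ultimately show ?thesis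
        by (auto simp: A_def intro: Inf_lower)
    qed
  qed
  then obtain m where m: "m \<le> F" "m \<noteq> bot" and
    min: "\<And>G. G \<le> m \<Longrightarrow> G \<noteq> bot \<Longrightarrow> G = m"
    unfolding A_def by (auto intro: order_trans)
  have "(\<forall>\<^sub>F x in m. P x) \<or> (\<forall>\<^sub>F x in m. \<not> P x)" for P
  \<comment> \<open>Adding \<open>{x. P x}\<close> to \<open>m\<close> gives either the improper
    filter, and then \<open>m\<close> contains the complement, or \<open>m\<close> itself by
    minimality.\<close>
  proof (cases "inf m (principal {x. P x}) = bot")
    case True
    then show ?thesis by (simp add: trivial_limit_def eventually_inf_principal)
  next
    case False
    then have "inf m (principal {x. P x}) = m" by (intro min) auto
    moreover have "\<forall>\<^sub>F x in inf m (principal {x. P x}). P x"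
      by (simp add: eventually_inf_principal)
    ultimately show ?thesis by simp
  qed
  then show ?thesis using m by (auto simp: ultrafilter_def)
qed

text \<open>Such a family is a filter base. Both ultrafilters in the counterexample to transitivity
  arise this way.\<close>

lemma ex_ultrafilter_directed:
  assumes "\<A> \<noteq> {}" and "{} \<notin> \<A>"
    and directed: "\<And>A B. A \<in> \<A> \<Longrightarrow> B \<in> \<A> \<Longrightarrow> \<exists>C\<in>\<A>. C \<subseteq> A \<inter> B"
  shows "\<exists>u. ultrafilter u \<and> (\<forall>A\<in>\<A>. \<forall>\<^sub>F x in u. x \<in> A)"
proof -
  define F where "F = Inf (principal ` \<A>)"
  have ev: "eventually P F \<longleftrightarrow> (\<exists>A\<in>\<A>. \<forall>x\<in>A. P x)" for P
    unfolding F_def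
    by (subst eventually_Inf_base) (use assms directed in \<open>auto simp: eventually_principal\<close>)
  have "F \<noteq> bot"
    using assms(2) by (auto simp: trivial_limit_def ev simp flip: ex_in_conv)
  then obtain u where "u \<le> F" "ultrafilter u"
    using ex_ultrafilter_le by blast
  moreover have "\<forall>\<^sub>F x in F. x \<in> A" if "A \<in> \<A>" for A
    using that by (auto simp: ev)
  ultimately show ?thesis by (auto intro: filter_leD)
qed

section \<open>Transfer and saturation\<close>

text \<open>Universal closure over the variables below \<open>n\<close>: elementarity only concerns
  standard assignments, and these quantifiers bring in the nonstandard values.\<close>

primrec forall_below :: "nat \<Rightarrow> fm \<Rightarrow> fm" where
  "forall_below 0 p = p"
| "forall_below (Suc n) p = forall_below n (Neg (Exists n (Neg p)))"

lemma well_formed_forall_below: "well_formed (forall_below n p) \<longleftrightarrow> well_formed p"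
  by (induction n arbitrary: p) auto

lemma sat_forall_below:
  "sat S e (forall_below n p) \<longleftrightarrow> (\<forall>e'. (\<forall>i\<ge>n. e' i = e i) \<longrightarrow> sat S e' p)"
proof (induction n arbitrary: p)
  case 0
  then show ?case by (auto simp: fun_eq_iff[symmetric])
next
  case (Suc n)
  have "(\<forall>e'. (\<forall>i\<ge>n. e' i = e i) \<longrightarrow> (\<forall>x. sat S (e'(n := x)) p)) \<longleftrightarrow>
        (\<forall>e'. (\<forall>i\<ge>Suc n. e' i = e i) \<longrightarrow> sat S e' p)"
  proof (intro iffI allI impI)
    fix e' assume *: "\<forall>e'. (\<forall>i\<ge>n. e' i = e i) \<longrightarrow> (\<forall>x. sat S (e'(n := x)) p)"
      and e': "\<forall>i\<ge>Suc n. e' i = e i"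
    \<comment> \<open>Resetting \<open>e'\<close> at \<open>n\<close> makes it agree with
      \<open>e\<close> from \<open>n\<close> on; the quantifier over \<open>x\<close> then restores
      \<open>e' n\<close>.\<close>
    have "\<forall>i\<ge>n. (e'(n := e n)) i = e i"
      using e' by (auto simp: Suc_le_eq)
    with * have "sat S ((e'(n := e n))(n := e' n)) p" by blast
    then show "sat S e' p" by simp
  qed auto
  then show ?case by (simp add: Suc)
qed

text \<open>The universal closure takes care of arbitrary values below \<open>n\<close>; from
  \<open>n\<close> on, \<open>e\<close> has to match a standard assignment, and the constant 0
  serves as the default.\<close>

lemma transfer:
  assumes "elementary_extension S \<iota>" and "well_formed p"
    and "\<And>e. sat (\<lambda>A. A) e p" and "\<forall>i\<ge>n. e i = \<iota> 0"
  shows "sat S e p"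
proof -
  have "sat (\<lambda>A. A) (\<lambda>_. 0) (forall_below n p)"
    using assms(3) by (simp add: sat_forall_below)
  then have "sat S (\<iota> \<circ> (\<lambda>_. 0)) (forall_below n p)"
    using assms(1,2) by (simp add: elementary_extension_def well_formed_forall_below)
  then show ?thesis
    using assms(4) by (simp add: sat_forall_below)
qed

lemma transfer_imp:
  fixes ks js :: "nat list"
  assumes "elementary_extension S \<iota>"
    and "A \<subseteq> tuples (length ks)" and "B \<subseteq> tuples (length js)"
    and "\<And>e. map e ks \<in> A \<Longrightarrow> map e js \<in> B"
    and "\<forall>i\<ge>n. e i = \<iota> 0" and "map e ks \<in> S A"
  shows "map e js \<in> S B"
  using transfer[OF assms(1), of "Neg (Conj (Rel A ks) (Neg (Rel B js)))" n e] assms by auto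

text \<open>Supplies the nonstandard witnesses for the finite satisfiability conditions of
  \<open>saturation\<close>.\<close>

lemma transfer_ex:
  fixes ks js :: "nat list"
  assumes "elementary_extension S \<iota>"
    and "A \<subseteq> tuples (length ks)" and "B \<subseteq> tuples (length js)"
    and "\<And>e. map e ks \<in> A \<Longrightarrow> \<exists>x. map (e(k := x)) js \<in> B"
    and "\<forall>i\<ge>n. e i = \<iota> 0" and "map e ks \<in> S A"
  shows "\<exists>x. map (e(k := x)) js \<in> S B"
  using transfer[OF assms(1), of "Neg (Conj (Rel A ks) (Neg (Exists k (Rel B js))))" n e] assms
  by auto

lemma transfer_Compl:
  fixes ks :: "nat list"
  assumes "elementary_extension S \<iota>" and "A \<subseteq> tuples (length ks)"
    and "\<forall>i\<ge>n. e i = \<iota> 0"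
  shows "map e ks \<in> S (tuples (length ks) - A) \<longleftrightarrow> map e ks \<notin> S A"
  using assms
    transfer[OF assms(1),
      of "Neg (Conj (Neg (Rel A ks)) (Neg (Rel (tuples (length ks) - A) ks)))" n e]
    transfer[OF assms(1), of "Neg (Conj (Rel A ks) (Rel (tuples (length ks) - A) ks))" n e]
  by (auto simp: tuples_def)

lemma finite_ordLess_cardSuc_continuum:
  assumes "finite P"
  shows "|P| <o cardSuc (ctwo ^c natLeq)"
proof -
  have "|P| <o natLeq" using assms finite_iff_ordLess_natLeq by blast
  also have "natLeq <o ctwo ^c natLeq" by (rule ordLess_ctwo_cexp[OF natLeq_Card_order])
  also have "ctwo ^c natLeq <o cardSuc (ctwo ^c natLeq)"
    by (rule cardSuc_greater[OF Card_order_cexp])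
  finally show ?thesis .
qed

text \<open>The type consists of atomic formulas. Directedness puts one member of the family below
  any finitely many, and inclusions transfer, so a witness for single members is enough.\<close>

lemma saturation:
  fixes ks :: "nat list"
  assumes el: "elementary_extension S \<iota>"
    and "saturated (cardSuc (ctwo ^c natLeq)) S"
    and e: "\<forall>i\<ge>n. e i = \<iota> 0"
    and "\<A> \<noteq> {}" and sub: "\<And>A. A \<in> \<A> \<Longrightarrow> A \<subseteq> tuples (length ks)"
    and directed: "\<And>A B. A \<in> \<A> \<Longrightarrow> B \<in> \<A> \<Longrightarrow> \<exists>C\<in>\<A>. C \<subseteq> A \<inter> B"
    and ex: "\<And>A. A \<in> \<A> \<Longrightarrow> \<exists>x. map (e(0 := x)) ks \<in> S A"
  shows "\<exists>x. \<forall>A\<in>\<A>. map (e(0 := x)) ks \<in> S A"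
proof -
  let ?\<Gamma> = "(\<lambda>A. (Rel A ks, e)) ` \<A>"
  have lower: "\<exists>B\<in>\<A>. \<forall>A\<in>\<D>. B \<subseteq> A" if "finite \<D>" "\<D> \<subseteq> \<A>" for \<D>
    using that
  proof (induction \<D>)
    case empty
    then show ?case using \<open>\<A> \<noteq> {}\<close> by auto
  next
    case (insert A \<D>)
    then obtain B where "B \<in> \<A>" "\<forall>A\<in>\<D>. B \<subseteq> A" by auto
    moreover obtain C where "C \<in> \<A>" "C \<subseteq> A \<inter> B"
      using directed insert.prems \<open>B \<in> \<A>\<close> by blast
    ultimately show ?case by (intro bexI[of _ C]) auto
  qed
  have fin: "\<exists>x. \<forall>(p, e) \<in> \<Delta>. sat S (e(0 := x)) p" if \<Delta>: "\<Delta> \<subseteq> ?\<Gamma>" "finite \<Delta>" for \<Delta>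
  proof -
    obtain \<D> where \<D>: "\<D> \<subseteq> \<A>" "finite \<D>" "\<Delta> = (\<lambda>A. (Rel A ks, e)) ` \<D>"
      using finite_subset_image[OF \<Delta>(2,1)] by blast
    obtain B where B: "B \<in> \<A>" "\<forall>A\<in>\<D>. B \<subseteq> A" using lower \<D> by blast
    obtain x where x: "map (e(0 := x)) ks \<in> S B" using ex B by blast
    have "map (e(0 := x)) ks \<in> S A" if "A \<in> \<D>" for A
      \<comment> \<open>\<open>Suc n\<close> and not \<open>n\<close>: if \<open>n = 0\<close>, the
        update at variable 0 can break the default condition.\<close>
      by (rule transfer_imp[OF el sub sub _ _ x, where n = "Suc n"])
        (use that B \<D> e in auto)
    then show ?thesis using \<D> by auto
  qed
  have "|e ` (set ks)| <o cardSuc (ctwo ^c natLeq)"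
    by (simp add: finite_ordLess_cardSuc_continuum)
  then have "\<exists>x. \<forall>(p, e) \<in> ?\<Gamma>. sat S (e(0 := x)) p"
    using assms(2)[unfolded saturated_def, rule_format, of "e ` set ks" ?\<Gamma>] fin sub by fastforce
  then show ?thesis by auto
qed

section \<open>Congruence modulo an ultrafilter, without the extension\<close>

definition dvd_closed :: "int set \<Rightarrow> bool" where
  "dvd_closed D \<longleftrightarrow> (\<forall>x y. x \<in> D \<longrightarrow> x dvd y \<longrightarrow> y \<in> D)"

lemma realizes_iff:
  assumes "realizes S xs u" and "A \<subseteq> tuples (length xs)"
  shows "xs \<in> S A \<longleftrightarrow> (\<forall>\<^sub>F ys in u. ys \<in> A)"
  using assms by (simp add: realizes_def)

text \<open>One implication suffices: the other follows by applying it to the complement, as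
  \<open>u\<close> is an ultrafilter.\<close>

lemma realizesI:
  fixes ks :: "nat list" and g :: "'b \<Rightarrow> int list"
  assumes el: "elementary_extension S \<iota>" and "ultrafilter u"
    and e: "\<forall>i\<ge>n. e i = \<iota> 0"
    and mem: "\<And>A. A \<subseteq> tuples (length ks) \<Longrightarrow> \<forall>\<^sub>F x in u. g x \<in> A \<Longrightarrow> map e ks \<in> S A"
    and g: "\<And>x. length (g x) = length ks"
  shows "realizes S (map e ks) (filtermap g u)"
  unfolding realizes_def eventually_filtermap
proof (intro allI impI iffI)
  fix A :: "int list set" assume A: "A \<subseteq> tuples (length (map e ks))"
  then show "map e ks \<in> S A" if "\<forall>\<^sub>F x in u. g x \<in> A" using mem that by simp
  show "\<forall>\<^sub>F x in u. g x \<in> A" if "map e ks \<in> S A"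
  proof (rule ccontr)
    assume "\<not> ?thesis"
    then have "\<forall>\<^sub>F x in u. g x \<notin> A" by (simp add: ultrafilter_eventually_not[OF assms(2)])
    then have "\<forall>\<^sub>F x in u. g x \<in> tuples (length ks) - A" by (simp add: tuples_def g)
    then have "map e ks \<in> S (tuples (length ks) - A)" by (intro mem) auto
    then show False using that transfer_Compl[OF el _ e] A by simp
  qed
qed

text \<open>Forward, the upward closure of \<open>D\<close> is transferred. Backward, saturation
  yields first \<open>a\<close>, then \<open>b\<close> over \<open>a\<close>, then \<open>d\<close>
  over both.\<close>

lemma ultra_cong_iff:
  assumes el: "elementary_extension S \<iota>"
    and sat: "saturated (cardSuc (ctwo ^c natLeq)) S"
    and w: "w \<in> betaZ"
  shows "(u, v) \<in> ultra_cong S w \<longleftrightarrow> u \<in> betaZ \<and> v \<in> betaZ \<and>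
    (\<forall>D. dvd_closed D \<longrightarrow> (\<forall>\<^sub>F z in w. z \<in> D) \<longrightarrow> (\<forall>\<^sub>F x in u. \<forall>\<^sub>F y in v. x - y \<in> D))"
    (is "_ \<longleftrightarrow> _ \<and> _ \<and> ?R")
proof (intro iffI)
  assume "(u, v) \<in> ultra_cong S w"
  then obtain d a b where uv: "u \<in> betaZ" "v \<in> betaZ"
    and d: "realizes S [d] (filtermap (\<lambda>x. [x]) w)"
    and ab: "realizes S [a, b] (filtermap (\<lambda>(x, y). [x, y]) (u \<otimes> v))"
    and dvd: "star_dvd_diff S d a b"
    by (auto simp: ultra_cong_def)
  have "\<forall>\<^sub>F x in u. \<forall>\<^sub>F y in v. x - y \<in> D" if D: "dvd_closed D" "\<forall>\<^sub>F z in w. z \<in> D" for D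
  proof -
    define e where "e = (\<lambda>_::nat. \<iota> 0)(0 := d, 1 := a, 2 := b)"
    have e: "\<forall>i\<ge>3. e i = \<iota> 0" by (auto simp: e_def)
    let ?D = "{[z] | z. z \<in> D}" and ?T = "{[x, y, z] | x y z :: int. x dvd y - z}"
      and ?E = "{[x, y] | x y. x - y \<in> D}"
    have "?D \<subseteq> tuples (length [d])" by (auto simp: tuples_def)
    then have d': "map e [0] \<in> S ?D"
      using d D(2) by (auto simp: realizes_iff eventually_filtermap e_def)
    \<comment> \<open>This expresses upward closure: \<open>z \<in> D\<close> and
      \<open>z dvd x - y\<close> imply \<open>x - y \<in> D\<close>.\<close>
    have "sat S e (Neg (Conj (Rel ?D [0]) (Conj (Rel ?T [0, 1, 2]) (Neg (Rel ?E [1, 2])))))"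
      by (rule transfer[OF el _ _ e]) (use D(1) in \<open>auto simp: tuples_def dvd_closed_def\<close>)
    then have "[a, b] \<in> S ?E"
      using dvd d' by (auto simp: star_dvd_diff_def e_def)
    moreover have "?E \<subseteq> tuples (length [a, b])" by (auto simp: tuples_def)
    ultimately have "\<forall>\<^sub>F xs in filtermap (\<lambda>(x, y). [x, y]) (u \<otimes> v). xs \<in> ?E"
      using ab by (simp add: realizes_iff)
    then show ?thesis by (simp add: eventually_filtermap eventually_tensor)
  qed
  then show "u \<in> betaZ \<and> v \<in> betaZ \<and> ?R" using uv by blast
next
  assume "u \<in> betaZ \<and> v \<in> betaZ \<and> ?R"
  then have uv: "u \<in> betaZ" "v \<in> betaZ" and R: ?R by auto
  have uf: "ultrafilter u" "ultrafilter v" "ultrafilter w" "ultrafilter (u \<otimes> v)"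
    using uv w by (auto simp: betaZ_def intro: ultrafilter_tensor)
  define e0 where "e0 = (\<lambda>_::nat. \<iota> 0)"
  have e0: "\<forall>i\<ge>0. e0 i = \<iota> 0" by (simp add: e0_def)

  have "\<exists>x. \<forall>A\<in>{A. A \<subseteq> tuples 1 \<and> (\<forall>\<^sub>F x in u. [x] \<in> A)}. map (e0(0 := x)) [0] \<in> S A"
  proof (rule saturation[OF el sat e0])
    fix A assume A: "A \<in> {A. A \<subseteq> tuples 1 \<and> (\<forall>\<^sub>F x in u. [x] \<in> A)}"
    then have "\<exists>x. [x] \<in> A"
      using uf(1) by (auto simp: ultrafilter_def dest!: eventually_happens')
    then have "sat S e0 (Exists 0 (Rel A [0]))"
      using A by (intro transfer[OF el _ _ e0]) (auto simp: tuples_def)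
    then show "\<exists>x. map (e0(0 := x)) [0] \<in> S A" by simp
  next
    fix A B assume "A \<in> {A. A \<subseteq> tuples 1 \<and> (\<forall>\<^sub>F x in u. [x] \<in> A)}"
      "B \<in> {A. A \<subseteq> tuples 1 \<and> (\<forall>\<^sub>F x in u. [x] \<in> A)}"
    then show "\<exists>C\<in>{A. A \<subseteq> tuples 1 \<and> (\<forall>\<^sub>F x in u. [x] \<in> A)}. C \<subseteq> A \<inter> B"
      by (intro bexI[of _ "A \<inter> B"]) (auto intro: eventually_conj)
  qed (auto simp: tuples_def)
  then obtain a where a: "\<And>A. A \<subseteq> tuples 1 \<Longrightarrow> \<forall>\<^sub>F x in u. [x] \<in> A \<Longrightarrow> [a] \<in> S A"
    by auto

  \<comment> \<open>Variable 0 is reserved for the element sought, so \<open>a\<close> is stored at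
    1 and later \<open>b\<close> at 2.\<close>
  define e1 where "e1 = e0(1 := a)"
  have e1: "\<forall>i\<ge>2. e1 i = \<iota> 0" by (simp add: e1_def e0_def)
  have "\<exists>x. \<forall>A\<in>{A. A \<subseteq> tuples 2 \<and> (\<forall>\<^sub>F (x, y) in u \<otimes> v. [x, y] \<in> A)}.
    map (e1(0 := x)) [1, 0] \<in> S A"
  proof (rule saturation[OF el sat e1])
    fix A assume A: "A \<in> {A. A \<subseteq> tuples 2 \<and> (\<forall>\<^sub>F (x, y) in u \<otimes> v. [x, y] \<in> A)}"
    \<comment> \<open>Almost all sections of \<open>A\<close> lie in \<open>v\<close> and so are
      nonempty. Thus \<open>a\<close> lies in the extension of the projection of \<open>A\<close>,
      and transfer gives a second coordinate.\<close>
    have "\<forall>\<^sub>F x in u. \<exists>y. [x, y] \<in> A"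
      using A uf(2)
      by (auto simp: eventually_tensor ultrafilter_def elim!: eventually_mono
        intro: eventually_happens')
    then have "[a] \<in> S {[x] | x. \<exists>y. [x, y] \<in> A}"
      by (intro a) (auto simp: tuples_def)
    then have e1_mem: "map e1 [1] \<in> S {[x] | x. \<exists>y. [x, y] \<in> A}" by (simp add: e1_def)
    show "\<exists>x. map (e1(0 := x)) [1, 0] \<in> S A"
      using A by (intro transfer_ex[OF el _ _ _ e1 e1_mem]) (auto simp: tuples_def)
  next
    fix A B assume "A \<in> {A. A \<subseteq> tuples 2 \<and> (\<forall>\<^sub>F (x, y) in u \<otimes> v. [x, y] \<in> A)}"
      "B \<in> {A. A \<subseteq> tuples 2 \<and> (\<forall>\<^sub>F (x, y) in u \<otimes> v. [x, y] \<in> A)}"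
    then show "\<exists>C\<in>{A. A \<subseteq> tuples 2 \<and> (\<forall>\<^sub>F (x, y) in u \<otimes> v. [x, y] \<in> A)}. C \<subseteq> A \<inter> B"
      by (intro bexI[of _ "A \<inter> B"]) (auto elim: eventually_elim2)
  qed (auto simp: tuples_def eventually_tensor intro!: exI[of _ "{xs. length xs = 2}"])
  then obtain b where b:
    "\<And>A. A \<subseteq> tuples 2 \<Longrightarrow> \<forall>\<^sub>F (x, y) in u \<otimes> v. [x, y] \<in> A \<Longrightarrow> [a, b] \<in> S A"
    by (auto simp: e1_def)

  \<comment> \<open>Merging both demands on \<open>d\<close> into one relation makes the family
    directed, through \<open>T (D \<inter> E)\<close>.\<close>
  define T where "T D = {[z, x, y] | z x y :: int. z \<in> D \<and> z dvd x - y}" for D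
  define e2 where "e2 = e1(2 := b)"
  have e2: "\<forall>i\<ge>3. e2 i = \<iota> 0" by (simp add: e2_def e1_def e0_def)
  have "\<exists>x. \<forall>A\<in>T ` {D. \<forall>\<^sub>F z in w. z \<in> D}. map (e2(0 := x)) [0, 1, 2] \<in> S A"
  proof (rule saturation[OF el sat e2])
    fix A assume "A \<in> T ` {D. \<forall>\<^sub>F z in w. z \<in> D}"
    then obtain D where D: "A = T D" "\<forall>\<^sub>F z in w. z \<in> D" by auto
    \<comment> \<open>The upward closure of \<open>D\<close>: the hypothesis applies to it, and
      membership of \<open>x - y\<close> provides the divisor required by
      \<open>T D\<close>.\<close>
    define D' where "D' = {y. \<exists>z\<in>D. z dvd y}"
    have "dvd_closed D'" by (auto simp: D'_def dvd_closed_def intro: dvd_trans)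
    moreover have "\<forall>\<^sub>F z in w. z \<in> D'"
      using D(2) by eventually_elim (auto simp: D'_def intro: dvd_refl)
    ultimately have "\<forall>\<^sub>F x in u. \<forall>\<^sub>F y in v. x - y \<in> D'" using R by blast
    then have "[a, b] \<in> S {[x, y] | x y. x - y \<in> D'}"
      by (intro b) (auto simp: tuples_def eventually_tensor)
    then have e2_mem: "map e2 [1, 2] \<in> S {[x, y] | x y. x - y \<in> D'}" by (simp add: e2_def e1_def)
    show "\<exists>x. map (e2(0 := x)) [0, 1, 2] \<in> S A"
      by (intro transfer_ex[OF el _ _ _ e2 e2_mem]) (auto simp: tuples_def D(1) T_def D'_def)
  next
    fix A B assume "A \<in> T ` {D. \<forall>\<^sub>F z in w. z \<in> D}" "B \<in> T ` {D. \<forall>\<^sub>F z in w. z \<in> D}"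
    then obtain D E where "A = T D" "B = T E" "\<forall>\<^sub>F z in w. z \<in> D" "\<forall>\<^sub>F z in w. z \<in> E"
      by auto
    then show "\<exists>C\<in>T ` {D. \<forall>\<^sub>F z in w. z \<in> D}. C \<subseteq> A \<inter> B"
      by (intro bexI[of _ "T (D \<inter> E)"] imageI) (auto simp: T_def intro: eventually_conj)
  qed (auto simp: T_def tuples_def intro!: exI[of _ UNIV])
  then obtain d where d: "\<And>D. \<forall>\<^sub>F z in w. z \<in> D \<Longrightarrow> [d, a, b] \<in> S (T D)"
    by (auto simp: e2_def e1_def)

  define e where "e = e2(0 := d)"
  have e: "\<forall>i\<ge>3. e i = \<iota> 0" and e_simps: "e 0 = d" "e (Suc 0) = a" "e 2 = b"
    using e2 by (auto simp: e_def e2_def e1_def)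
  have "realizes S (map e [0]) (filtermap (\<lambda>x. [x]) w)"
  proof (rule realizesI[OF el uf(3) e])
    fix A :: "int list set"
    assume A: "A \<subseteq> tuples (length [0::nat])" "\<forall>\<^sub>F x in w. [x] \<in> A"
    \<comment> \<open>The first coordinate of a triple in \<open>T {x. [x] \<in> A}\<close> lies in
      \<open>A\<close>, so the same family shows that \<open>d\<close> realizes
      \<open>w\<close>.\<close>
    then have e_mem: "map e [0, 1, 2] \<in> S (T {x. [x] \<in> A})" using d by (simp add: e_simps)
    show "map e [0] \<in> S A"
      by (intro transfer_imp[OF el _ A(1) _ e e_mem])
        (auto simp: T_def tuples_def)
  qed auto
  moreover have "realizes S (map e [1, 2]) (filtermap (\<lambda>(x, y). [x, y]) (u \<otimes> v))"
  proof (rule realizesI[OF el uf(4) e])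
    fix A :: "int list set"
    assume "A \<subseteq> tuples (length [1, 2 :: nat])" "\<forall>\<^sub>F z in u \<otimes> v. (case z of (x, y) \<Rightarrow> [x, y]) \<in> A"
    then have "[a, b] \<in> S A"
      by (intro b) (auto simp: tuples_def eventually_tensor)
    then show "map e [1, 2] \<in> S A" by (simp add: e_simps)
  qed auto
  moreover have "star_dvd_diff S d a b"
    using d[of UNIV] by (simp add: star_dvd_diff_def T_def)
  ultimately show "(u, v) \<in> ultra_cong S w"
    using uv by (auto simp: ultra_cong_def e_simps)
qed

section \<open>Self-divisible ultrafilters and transitivity\<close>

lemma dvd_diff_trans:
  fixes n :: "'b::comm_ring_1"
  assumes "n dvd x - y" and "n dvd y - z"
  shows "n dvd x - z"
  using dvd_add[OF assms] by simp

text \<open>The residue classes are finitely many, so an ultrafilter contains one of them.\<close>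

lemma ultrafilter_residue:
  fixes n :: int
  assumes "ultrafilter u" and "n \<noteq> 0"
  obtains r where "\<forall>\<^sub>F x in u. n dvd x - r"
proof -
  have "\<exists>r\<in>{0..<\<bar>n\<bar>}. n dvd x - r" for x
    using assms(2) by (intro bexI[of _ "x mod \<bar>n\<bar>"]) (auto simp: minus_mod_eq_mult_div)
  then have "\<exists>r\<in>{0..<\<bar>n\<bar>}. \<forall>\<^sub>F x in u. n dvd x - r"
    by (intro ultrafilter_eventually_bex[OF assms(1)]) auto
  then show ?thesis using that by blast
qed

text \<open>Turns the asymmetric condition on the tensor product into equality of residues, where
  symmetry and transitivity are visible.\<close>

lemma eventually_dvd_diff_iff:
  fixes n :: int
  assumes "ultrafilter u" and "ultrafilter v" and "n \<noteq> 0"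
  shows "(\<forall>\<^sub>F x in u. \<forall>\<^sub>F y in v. n dvd x - y) \<longleftrightarrow>
    (\<exists>r. (\<forall>\<^sub>F x in u. n dvd x - r) \<and> (\<forall>\<^sub>F y in v. n dvd y - r))"
proof
  assume *: "\<forall>\<^sub>F x in u. \<forall>\<^sub>F y in v. n dvd x - y"
  obtain r where r: "\<forall>\<^sub>F y in v. n dvd y - r"
    using ultrafilter_residue[OF assms(2,3)] .
  from * have "\<forall>\<^sub>F x in u. n dvd x - r"
  proof eventually_elim
    case (elim x)
    with r have "\<forall>\<^sub>F y in v. n dvd x - r"
      by eventually_elim (metis elim dvd_diff_trans)
    then show ?case using assms(2) by (simp add: ultrafilter_def)
  qed
  with r show "\<exists>r. (\<forall>\<^sub>F x in u. n dvd x - r) \<and> (\<forall>\<^sub>F y in v. n dvd y - r)" by blast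
next
  assume "\<exists>r. (\<forall>\<^sub>F x in u. n dvd x - r) \<and> (\<forall>\<^sub>F y in v. n dvd y - r)"
  then obtain r where r: "\<forall>\<^sub>F x in u. n dvd x - r" "\<forall>\<^sub>F y in v. n dvd y - r" by blast
  from r(1) show "\<forall>\<^sub>F x in u. \<forall>\<^sub>F y in v. n dvd x - y"
  proof eventually_elim
    case (elim x)
    from r(2) show ?case
      by eventually_elim (metis elim dvd_diff_commute dvd_diff_trans)
  qed
qed

lemma betaZ_eventually_zero:
  assumes "w \<in> betaZ" and "\<forall>\<^sub>F x in w. x = 0"
  shows "w = principal {0}"
proof (rule filter_eqI)
  fix P
  have "(\<forall>\<^sub>F x in w. P x) \<longleftrightarrow> (\<forall>\<^sub>F x in w. P 0)"
    by (rule eventually_cong[OF assms(2)]) simp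
  then show "(\<forall>\<^sub>F x in w. P x) \<longleftrightarrow> (\<forall>\<^sub>F x in principal {0}. P x)"
    using assms(1) by (auto simp: eventually_principal betaZ_def ultrafilter_def)
qed

lemma betaZ_eventually_nonzero:
  assumes "w \<in> betaZ - {principal {0}}"
  shows "\<forall>\<^sub>F x in w. x \<noteq> 0"
  using assms betaZ_eventually_zero by (auto simp: ultrafilter_eventually_not betaZ_def)

section \<open>The self-divisible case\<close>

definition self_divisible :: "int filter \<Rightarrow> bool" where
  "self_divisible w \<longleftrightarrow> (\<forall>\<^sub>F n in w. \<forall>\<^sub>F z in w. n dvd z)"

text \<open>An upward closed \<open>D\<close> in \<open>w\<close> contains some \<open>n\<close>
  whose multiples form a set in \<open>w\<close>, and with it all multiples of \<open>n\<close>.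
  Hence these sets of multiples suffice as tests.\<close>

lemma ultra_cong_iff_self_divisible:
  assumes "elementary_extension S \<iota>"
    and "saturated (cardSuc (ctwo ^c natLeq)) S"
    and w: "w \<in> betaZ - {principal {0}}" and sd: "self_divisible w"
  shows "(u, v) \<in> ultra_cong S w \<longleftrightarrow> u \<in> betaZ \<and> v \<in> betaZ \<and>
    (\<forall>n. (\<forall>\<^sub>F z in w. n dvd z) \<longrightarrow>
      (\<exists>r. (\<forall>\<^sub>F x in u. n dvd x - r) \<and> (\<forall>\<^sub>F y in v. n dvd y - r)))"
proof -
  have wb: "w \<in> betaZ" using w by simp
  \<comment> \<open>\<open>n = 0\<close> would make \<open>w\<close> principal at 0, and residues
    modulo 0 need not exist.\<close>
  have nz: "n \<noteq> 0" if "\<forall>\<^sub>F z in w. n dvd z" for n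
    using that betaZ_eventually_zero[OF wb] w by auto
  have "(\<forall>D. dvd_closed D \<longrightarrow> (\<forall>\<^sub>F z in w. z \<in> D) \<longrightarrow> (\<forall>\<^sub>F x in u. \<forall>\<^sub>F y in v. x - y \<in> D)) \<longleftrightarrow>
    (\<forall>n. (\<forall>\<^sub>F z in w. n dvd z) \<longrightarrow> (\<forall>\<^sub>F x in u. \<forall>\<^sub>F y in v. n dvd x - y))"
  proof (intro iffI allI impI)
    fix n assume *: "\<forall>D. dvd_closed D \<longrightarrow> (\<forall>\<^sub>F z in w. z \<in> D) \<longrightarrow>
      (\<forall>\<^sub>F x in u. \<forall>\<^sub>F y in v. x - y \<in> D)" and n: "\<forall>\<^sub>F z in w. n dvd z"
    have "dvd_closed {z. n dvd z}" by (auto simp: dvd_closed_def intro: dvd_trans)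
    with *[rule_format, of "{z. n dvd z}"] n
    show "\<forall>\<^sub>F x in u. \<forall>\<^sub>F y in v. n dvd x - y" by simp
  next
    fix D assume *: "\<forall>n. (\<forall>\<^sub>F z in w. n dvd z) \<longrightarrow> (\<forall>\<^sub>F x in u. \<forall>\<^sub>F y in v. n dvd x - y)"
      and D: "dvd_closed D" "\<forall>\<^sub>F z in w. z \<in> D"
    have "\<forall>\<^sub>F n in w. n \<in> D \<and> (\<forall>\<^sub>F z in w. n dvd z)"
      using D(2) sd by (simp add: self_divisible_def eventually_conj)
    then obtain n where n: "n \<in> D" "\<forall>\<^sub>F z in w. n dvd z"
      using wb by (auto simp: betaZ_def ultrafilter_def dest: eventually_happens')
    with * have "\<forall>\<^sub>F x in u. \<forall>\<^sub>F y in v. n dvd x - y" by blast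
    then show "\<forall>\<^sub>F x in u. \<forall>\<^sub>F y in v. x - y \<in> D"
      using n(1) D(1) by (auto simp: dvd_closed_def elim!: eventually_mono)
  qed
  then show ?thesis
    unfolding ultra_cong_iff[OF assms(1,2) wb]
    using eventually_dvd_diff_iff[of u v] nz by (auto simp: betaZ_def)
qed

lemma equiv_ultra_cong_if_self_divisible:
  assumes "elementary_extension S \<iota>"
    and "saturated (cardSuc (ctwo ^c natLeq)) S"
    and w: "w \<in> betaZ - {principal {0}}" and "self_divisible w"
  shows "equiv betaZ (ultra_cong S w)"
proof -
  note iff = ultra_cong_iff_self_divisible[OF assms]
  have nz: "n \<noteq> 0" if "\<forall>\<^sub>F z in w. n dvd z" for n
    using that betaZ_eventually_zero[of w] w by auto
  show ?thesis
  proof (rule equivI)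
    show "ultra_cong S w \<subseteq> betaZ \<times> betaZ" by (auto simp: ultra_cong_def)
    show "refl_on betaZ (ultra_cong S w)"
      by (rule refl_onI) (use nz ultrafilter_residue in \<open>auto simp: iff betaZ_def, metis\<close>)
    show "sym (ultra_cong S w)" by (rule symI) (auto simp: iff)
    show "trans (ultra_cong S w)"
    proof (rule transI)
      fix u v t assume uv: "(u, v) \<in> ultra_cong S w" and vt: "(v, t) \<in> ultra_cong S w"
      have "\<exists>r. (\<forall>\<^sub>F x in u. n dvd x - r) \<and> (\<forall>\<^sub>F y in t. n dvd y - r)"
        if n: "\<forall>\<^sub>F z in w. n dvd z" for n
      proof -
        obtain r s where r: "\<forall>\<^sub>F x in u. n dvd x - r" "\<forall>\<^sub>F x in v. n dvd x - r"
          and s: "\<forall>\<^sub>F x in v. n dvd x - s" "\<forall>\<^sub>F x in t. n dvd x - s"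
          using uv vt n by (metis iff)
        \<comment> \<open>Two residue classes modulo \<open>n\<close> that both belong to
          \<open>v\<close> coincide.\<close>
        from r(2) s(1) have "\<forall>\<^sub>F x in v. n dvd s - r"
          by eventually_elim (metis dvd_diff_commute dvd_diff_trans)
        then have "n dvd s - r" using uv by (simp add: iff betaZ_def ultrafilter_def)
        from s(2) have "\<forall>\<^sub>F x in t. n dvd x - r"
          by eventually_elim (rule dvd_diff_trans[OF _ \<open>n dvd s - r\<close>])
        then show ?thesis using r(1) by blast
      qed
      then show "(u, t) \<in> ultra_cong S w" using uv vt by (simp add: iff)
    qed
  qed
qed

section \<open>Failure of transitivity without self-divisibility\<close>

lemma ex_multiple_with_residue:
  fixes n d r :: int
  assumes "gcd d n dvd r"
  obtains k where "n dvd d * k - r"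
proof -
  obtain a b where ab: "a * d + b * n = gcd d n" using bezout_int by blast
  obtain c where c: "r = gcd d n * c" using assms by (auto elim: dvdE)
  have "d * (a * c) - r = - (n * (b * c))"
    unfolding c ab[symmetric] by (simp add: algebra_simps)
  then have "n dvd d * (a * c) - r" by simp
  then show ?thesis using that by blast
qed

lemma self_divisible_if_trans:
  assumes "elementary_extension S \<iota>"
    and "saturated (cardSuc (ctwo ^c natLeq)) S"
    and w: "w \<in> betaZ - {principal {0}}" and tr: "trans (ultra_cong S w)"
  shows "self_divisible w"
proof (rule ccontr)
  assume not_sd: "\<not> self_divisible w"
  have wb: "w \<in> betaZ" and wu: "ultrafilter w" and w_bot: "w \<noteq> bot"
    using w by (auto simp: betaZ_def ultrafilter_def)
  note iff = ultra_cong_iff[OF assms(1,2) wb]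
  define N where "N = {n. \<forall>\<^sub>F z in w. n dvd z}"

  \<comment> \<open>Each set contains its own index \<open>n\<close>, and least common multiples
    make the family directed.\<close>
  have "\<exists>u. ultrafilter u \<and> (\<forall>A\<in>(\<lambda>n. {m \<in> N. n dvd m}) ` N. \<forall>\<^sub>F x in u. x \<in> A)"
  proof (rule ex_ultrafilter_directed)
    have "1 \<in> N" unfolding N_def mem_Collect_eq by (rule always_eventually) simp
    then show "(\<lambda>n. {m \<in> N. n dvd m}) ` N \<noteq> {}" by blast
    fix A B assume "A \<in> (\<lambda>n. {m \<in> N. n dvd m}) ` N" "B \<in> (\<lambda>n. {m \<in> N. n dvd m}) ` N"
    then obtain m n where "m \<in> N" "n \<in> N" "A = {k \<in> N. m dvd k}" "B = {k \<in> N. n dvd k}" by auto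
    moreover from this have "lcm m n \<in> N"
      by (auto simp: N_def elim: eventually_elim2)
    ultimately show "\<exists>C\<in>(\<lambda>n. {m \<in> N. n dvd m}) ` N. C \<subseteq> A \<inter> B"
      by (intro bexI[of _ "{k \<in> N. lcm m n dvd k}"] imageI) auto
  qed auto
  then obtain u where u: "ultrafilter u"
    and u_N: "\<And>n. n \<in> N \<Longrightarrow> \<forall>\<^sub>F x in u. x \<in> N \<and> n dvd x" by auto

  \<comment> \<open>Pairs index the constraints on \<open>v\<close>: lie in \<open>D\<close> and
    share the residue of \<open>u\<close> modulo \<open>n\<close>. Intersections and products of
    moduli give directedness.\<close>
  let ?I = "{(D, n :: int). dvd_closed D \<and> (\<forall>\<^sub>F z in w. z \<in> D) \<and> n \<noteq> 0}"
  define B where "B = (\<lambda>(D, n). {y \<in> D. \<forall>\<^sub>F x in u. n dvd x - y})"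
  have "\<exists>v. ultrafilter v \<and> (\<forall>A\<in>B ` ?I. \<forall>\<^sub>F x in v. x \<in> A)"
  proof (rule ex_ultrafilter_directed)
    have "(UNIV, 1) \<in> ?I" by (simp add: dvd_closed_def)
    then show "B ` ?I \<noteq> {}" by blast
  next
    fix X Y assume "X \<in> B ` ?I" "Y \<in> B ` ?I"
    then obtain D m E n where *: "(D, m) \<in> ?I" "X = B (D, m)" "(E, n) \<in> ?I" "Y = B (E, n)"
      by auto
    then have "(D \<inter> E, m * n) \<in> ?I" by (auto simp: dvd_closed_def eventually_conj_iff)
    moreover have "B (D \<inter> E, m * n) \<subseteq> X \<inter> Y"
      using * by (auto simp: B_def elim!: eventually_mono intro: dvd_mult_left dvd_mult_right)
    ultimately show "\<exists>C\<in>B ` ?I. C \<subseteq> X \<inter> Y" by blast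
  next
    have "B (D, n) \<noteq> {}" if "(D, n) \<in> ?I" for D n
    proof -
      have D: "dvd_closed D" "\<forall>\<^sub>F z in w. z \<in> D" and n: "n \<noteq> 0" using that by auto
      obtain s where s: "\<forall>\<^sub>F z in w. n dvd z - s" using ultrafilter_residue[OF wu n] .
      \<comment> \<open>\<open>gcd z n\<close> depends only on the residue of \<open>z\<close>, so
        it equals \<open>gcd s n\<close> on a set in \<open>w\<close>; this puts
        \<open>gcd s n\<close> into \<open>N\<close>.\<close>
      have gcd_eq: "gcd z n = gcd s n" if "n dvd z - s" for z
        using that by (metis gcd_red_int mod_eq_dvd_iff)
      have "gcd s n \<in> N"
        unfolding N_def using s by (auto elim!: eventually_mono simp flip: gcd_eq)
      obtain r where r: "\<forall>\<^sub>F x in u. n dvd x - r" using ultrafilter_residue[OF u n] .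
      \<comment> \<open>By the choice of \<open>u\<close>, \<open>gcd s n\<close> divides almost
        every \<open>x\<close>; it also divides \<open>n\<close>, hence
        \<open>x - r\<close>.\<close>
      have "\<forall>\<^sub>F x in u. gcd s n dvd r"
        using r u_N[OF \<open>gcd s n \<in> N\<close>]
      proof eventually_elim
        case (elim x)
        then have "gcd s n dvd x - (x - r)" by (meson dvd_diff dvd_trans gcd_dvd2)
        then show ?case by simp
      qed
      then have "gcd s n dvd r" using u by (simp add: ultrafilter_def)
      \<comment> \<open>The residue \<open>s\<close> ensures \<open>gcd d n = gcd s n\<close>, so
        that Bezout applies; upward closure then keeps \<open>d * k\<close> in
        \<open>D\<close>.\<close>
      moreover obtain d where d: "d \<in> D" "n dvd d - s"
        using eventually_happens'[OF w_bot eventually_conj[OF D(2) s]] by blast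
      ultimately have "gcd d n dvd r" by (simp add: gcd_eq[OF d(2)])
      then obtain k where k: "n dvd d * k - r" by (rule ex_multiple_with_residue)
      have "\<forall>\<^sub>F x in u. n dvd x - d * k"
        using r by eventually_elim (metis k dvd_diff_commute dvd_diff_trans)
      moreover have "d * k \<in> D" using D(1) d(1) by (auto simp: dvd_closed_def)
      ultimately show ?thesis by (auto simp: B_def)
    qed
    then show "{} \<notin> B ` ?I" by force
  qed
  then obtain v where v: "ultrafilter v"
    and v_B: "\<And>D n. dvd_closed D \<Longrightarrow> \<forall>\<^sub>F z in w. z \<in> D \<Longrightarrow> n \<noteq> 0 \<Longrightarrow>
      \<forall>\<^sub>F y in v. y \<in> D \<and> (\<forall>\<^sub>F x in u. n dvd x - y)"
    by (auto simp: B_def)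

  have uv_betaZ: "u \<in> betaZ" "v \<in> betaZ" "principal {0} \<in> betaZ"
    using u v by (auto simp: betaZ_def ultrafilter_principal_singleton)
  have "(v, principal {0}) \<in> ultra_cong S w"
    unfolding iff
  proof (intro conjI uv_betaZ allI impI)
    fix D assume "dvd_closed D" "\<forall>\<^sub>F z in w. z \<in> D"
    \<comment> \<open>Modulus 1 makes the congruence vacuous and leaves membership in
      \<open>D\<close>.\<close>
    from v_B[OF this, of 1] show "\<forall>\<^sub>F x in v. \<forall>\<^sub>F y in principal {0}. x - y \<in> D"
      by (auto simp: eventually_principal elim!: eventually_mono)
  qed
  moreover have "(u, v) \<in> ultra_cong S w"
    unfolding iff
  proof (intro conjI uv_betaZ allI impI)
    fix D assume D: "dvd_closed D" "\<forall>\<^sub>F z in w. z \<in> D"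
    \<comment> \<open>One nonzero \<open>n \<in> D\<close> suffices: equal residues modulo
      \<open>n\<close> put the differences among its multiples, all in \<open>D\<close>.\<close>
    obtain n where n: "n \<in> D" "n \<noteq> 0"
      using eventually_happens'[OF w_bot eventually_conj[OF D(2) betaZ_eventually_nonzero[OF w]]]
      by blast
    obtain r where r: "\<forall>\<^sub>F x in u. n dvd x - r" using ultrafilter_residue[OF u n(2)] .
    have "\<forall>\<^sub>F y in v. n dvd y - r"
      using v_B[OF D n(2)]
    proof eventually_elim
      case (elim y)
      then have "\<forall>\<^sub>F x in u. n dvd x - y" by blast
      with r have "\<forall>\<^sub>F x in u. n dvd y - r"
        by eventually_elim (metis dvd_diff_commute dvd_diff_trans)
      then show ?case using u by (simp add: ultrafilter_def)
    qed
    with r have "\<forall>\<^sub>F x in u. \<forall>\<^sub>F y in v. n dvd x - y"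
      using eventually_dvd_diff_iff[OF u v n(2)] by blast
    then show "\<forall>\<^sub>F x in u. \<forall>\<^sub>F y in v. x - y \<in> D"
      using n(1) D(1) by (auto simp: dvd_closed_def elim!: eventually_mono)
  qed
  ultimately have "(u, principal {0}) \<in> ultra_cong S w"
    using tr by (blast dest: transD)
  \<comment> \<open>A divisor of an element of \<open>N\<close> is in \<open>N\<close>, so
    \<open>- N\<close> is upward closed and can test the congruence of \<open>u\<close> with
    0.\<close>
  moreover have "dvd_closed (- N)"
    unfolding dvd_closed_def N_def by (blast intro: eventually_mono dvd_trans)
  moreover have "\<forall>\<^sub>F z in w. z \<in> - N"
    using not_sd by (simp add: self_divisible_def N_def ultrafilter_eventually_not[OF wu])
  ultimately have "\<forall>\<^sub>F x in u. \<forall>\<^sub>F y in principal {0}. x - y \<in> - N"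
    unfolding iff by blast
  then have "\<forall>\<^sub>F x in u. x \<notin> N" by (simp add: eventually_principal)
  moreover have "1 \<in> N"
    unfolding N_def mem_Collect_eq by (rule always_eventually) simp
  then have "\<forall>\<^sub>F x in u. x \<in> N"
    using u_N[of 1] by simp
  ultimately show False using ultrafilter_eventually_not[OF u] by blast
qed

theorem theorem2p3:
  fixes S :: "int list set \<Rightarrow> 'a list set"
    and \<iota> :: "int \<Rightarrow> 'a"
    and w :: "int filter"
  assumes "elementary_extension S \<iota>"
    and "saturated (cardSuc (ctwo ^c natLeq)) S"
    and "w \<in> betaZ - {principal {0}}"
  shows "equiv betaZ (ultra_cong S w) \<longleftrightarrow> trans (ultra_cong S w)"
  using equiv_ultra_cong_if_self_divisible[OF assms] self_divisible_if_trans[OF assms]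
  by (auto elim: equivE)

end
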